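(* Let $(f_i: G_i \to H_i)_{i\in I}$ be any family of c-proper continuous homomorphisms of (not necessarily Hausdorff) topological groups. Then the product $\prod_{i\in I} f_i : \prod_{i\in I} G_i \to \prod_{i\in I} H_i$ is c-proper.
   Context: Topological groups are not assumed to be Hausdorff. A continuous homomorphism $f:G\to H$ is c-closed if $f(A)$ is closed in $H$ for every closed subgroup $A\le G$. It is c-proper if for every topological group $K$ and every continuous homomorphism $g:K\to H$, the projection $p_2: G\times_H K=\{(x,y)\in G\times K : f(x)=g(y)\}\to K$ is c-closed. *)

theory Defs
  imports "HOL-Analysis.Analysis" "HOL-Algebra.Product_Groups"
begin

text \<open>Topological groups are given by a carrier-based group together with a topology whose
  underlying set is the carrier. No separation axiom is imposed.\<close>

definition topological_group :: "'a monoid \<Rightarrow> 'a topology \<Rightarrow> bool" where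
  "topological_group G S \<longleftrightarrow>
     group G \<and> topspace S = carrier G \<and>
     continuous_map (prod_topology S S) S (\<lambda>(x, y). x \<otimes>\<^bsub>G\<^esub> y) \<and>
     continuous_map S S (\<lambda>x. inv\<^bsub>G\<^esub> x)"

definition continuous_hom ::
  "'a monoid \<Rightarrow> 'a topology \<Rightarrow> 'b monoid \<Rightarrow> 'b topology \<Rightarrow> ('a \<Rightarrow> 'b) \<Rightarrow> bool" where
  "continuous_hom G S H T f \<longleftrightarrow>
     topological_group G S \<and> topological_group H T \<and> f \<in> hom G H \<and> continuous_map S T f"

definition c_closed ::
  "'a monoid \<Rightarrow> 'a topology \<Rightarrow> 'b monoid \<Rightarrow> 'b topology \<Rightarrow> ('a \<Rightarrow> 'b) \<Rightarrow> bool" where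
  "c_closed G S H T f \<longleftrightarrow>
     continuous_hom G S H T f \<and>
     (\<forall>A. subgroup A G \<and> closedin S A \<longrightarrow> closedin T (f ` A))"

definition fibre_product_set ::
  "'a monoid \<Rightarrow> 'k monoid \<Rightarrow> ('a \<Rightarrow> 'b) \<Rightarrow> ('k \<Rightarrow> 'b) \<Rightarrow> ('a \<times> 'k) set" where
  "fibre_product_set G K f g = {(x, y). x \<in> carrier G \<and> y \<in> carrier K \<and> f x = g y}"

definition fibre_product_group ::
  "'a monoid \<Rightarrow> 'k monoid \<Rightarrow> ('a \<Rightarrow> 'b) \<Rightarrow> ('k \<Rightarrow> 'b) \<Rightarrow> ('a \<times> 'k) monoid" where
  "fibre_product_group G K f g = (G \<times>\<times> K)\<lparr>carrier := fibre_product_set G K f g\<rparr>"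

definition fibre_product_topology ::
  "'a monoid \<Rightarrow> 'a topology \<Rightarrow> 'k monoid \<Rightarrow> 'k topology \<Rightarrow> ('a \<Rightarrow> 'b) \<Rightarrow> ('k \<Rightarrow> 'b)
     \<Rightarrow> ('a \<times> 'k) topology" where
  "fibre_product_topology G S K R f g =
     subtopology (prod_topology S R) (fibre_product_set G K f g)"

text \<open>HOL cannot quantify over types inside a formula, so the type of the elements of the
  test groups \<open>K\<close> is an explicit parameter. A map is c-proper in the unrestricted sense iff
  \<open>c_proper TYPE('k)\<close> holds for every type \<open>'k\<close>. Lemma \<open>c_proper_all_types\<close> below shows that
  for this the single instance \<open>c_proper TYPE('a \<times> nat)\<close>, with \<open>'a\<close> the type of the elements
  of the domain, is already enough.\<close>

definition c_proper ::
  "'k itself \<Rightarrow> 'a monoid \<Rightarrow> 'a topology \<Rightarrow> 'b monoid \<Rightarrow> 'b topology \<Rightarrow> ('a \<Rightarrow> 'b) \<Rightarrow> bool" where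
  "c_proper _ G S H T f \<longleftrightarrow>
     continuous_hom G S H T f \<and>
     (\<forall>(K :: 'k monoid) R g. continuous_hom K R H T g \<longrightarrow>
        c_closed (fibre_product_group G K f g) (fibre_product_topology G S K R f g) K R snd)"


subsection \<open>Fibre products are topological groups\<close>

lemma topological_groupD:
  assumes "topological_group G S"
  shows "group G" "topspace S = carrier G"
    "continuous_map (prod_topology S S) S (\<lambda>(x, y). x \<otimes>\<^bsub>G\<^esub> y)"
    "continuous_map S S (\<lambda>x. inv\<^bsub>G\<^esub> x)"
  using assms by (auto simp: topological_group_def)

lemma continuous_homD:
  assumes "continuous_hom G S H T f"
  shows "topological_group G S" "topological_group H T" "f \<in> hom G H" "continuous_map S T f"
    "group_hom G H f"
  using assms
  by (auto simp: continuous_hom_def topological_group_def group_hom_def group_hom_axioms_def)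

lemma fibre_product_group_simps [simp]:
  "carrier (fibre_product_group G K f g) = fibre_product_set G K f g"
  "x \<otimes>\<^bsub>fibre_product_group G K f g\<^esub> y = (fst x \<otimes>\<^bsub>G\<^esub> fst y, snd x \<otimes>\<^bsub>K\<^esub> snd y)"
  "\<one>\<^bsub>fibre_product_group G K f g\<^esub> = (\<one>\<^bsub>G\<^esub>, \<one>\<^bsub>K\<^esub>)"
  by (auto simp: fibre_product_group_def DirProd_def split: prod.splits)

lemma mem_fibre_product_set [simp]:
  "(x, y) \<in> fibre_product_set G K f g \<longleftrightarrow> x \<in> carrier G \<and> y \<in> carrier K \<and> f x = g y"
  by (simp add: fibre_product_set_def)

lemma fibre_product_group:
  assumes "group_hom G H f" "group_hom K H g"
  shows "group (fibre_product_group G K f g)"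
proof -
  interpret f: group_hom G H f by fact
  interpret g: group_hom K H g by fact
  show ?thesis
  proof (rule groupI)
    fix x assume "x \<in> carrier (fibre_product_group G K f g)"
    then show "\<exists>y\<in>carrier (fibre_product_group G K f g).
        y \<otimes>\<^bsub>fibre_product_group G K f g\<^esub> x = \<one>\<^bsub>fibre_product_group G K f g\<^esub>"
      by (intro bexI[of _ "(inv\<^bsub>G\<^esub> fst x, inv\<^bsub>K\<^esub> snd x)"]) (auto simp: fibre_product_set_def)
  qed (auto simp: fibre_product_set_def f.G.m_assoc g.G.m_assoc)
qed

lemma fibre_product_inv:
  assumes "group_hom G H f" "group_hom K H g" "x \<in> fibre_product_set G K f g"
  shows "inv\<^bsub>fibre_product_group G K f g\<^esub> x = (inv\<^bsub>G\<^esub> fst x, inv\<^bsub>K\<^esub> snd x)"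
proof -
  interpret f: group_hom G H f by fact
  interpret g: group_hom K H g by fact
  interpret P: group "fibre_product_group G K f g"
    using assms fibre_product_group by blast
  show ?thesis
    by (rule P.inv_equality) (use assms(3) in \<open>auto simp: fibre_product_set_def\<close>)
qed

lemma topspace_fibre_product:
  assumes "topspace S = carrier G" "topspace R = carrier K"
  shows "topspace (fibre_product_topology G S K R f g) = fibre_product_set G K f g"
  using assms by (auto simp: fibre_product_topology_def fibre_product_set_def)

lemma fibre_product_topological_group:
  assumes f: "continuous_hom G S H T f" and g: "continuous_hom K R H T g"
  shows "topological_group (fibre_product_group G K f g) (fibre_product_topology G S K R f g)"
    (is "topological_group ?P ?X")
proof -
  note fD = continuous_homD[OF f] and gD = continuous_homD[OF g]
  note GD = topological_groupD[OF fD(1)] and KD = topological_groupD[OF gD(1)]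
  have grp: "group ?P" using fD(5) gD(5) by (rule fibre_product_group)
  have top: "topspace ?X = carrier ?P"
    by (simp add: topspace_fibre_product GD KD)
  have fst: "continuous_map ?X S fst" and snd: "continuous_map ?X R snd"
    by (auto simp: fibre_product_topology_def
          intro!: continuous_map_from_subtopology continuous_map_fst continuous_map_snd)
  have mul: "continuous_map (prod_topology Y Y') Y'' (\<lambda>(x, y). m x y) \<Longrightarrow>
      continuous_map Z Y p \<Longrightarrow> continuous_map Z Y' q \<Longrightarrow>
      continuous_map Z Y'' (\<lambda>z. m (p z) (q z))"
    for Y :: "'u topology" and Y' :: "'v topology" and Y'' :: "'w topology"
      and Z :: "'z topology" and p q and m :: "'u \<Rightarrow> 'v \<Rightarrow> 'w"
    using continuous_map_compose[of Z "prod_topology Y Y'" "\<lambda>z. (p z, q z)" Y'' "\<lambda>(x, y). m x y"]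
    by (simp add: o_def continuous_map_paired)
  have p1: "continuous_map (prod_topology ?X ?X) S (\<lambda>z. fst (fst z))"
    and p2: "continuous_map (prod_topology ?X ?X) S (\<lambda>z. fst (snd z))"
    and q1: "continuous_map (prod_topology ?X ?X) R (\<lambda>z. snd (fst z))"
    and q2: "continuous_map (prod_topology ?X ?X) R (\<lambda>z. snd (snd z))"
    using continuous_map_compose[OF continuous_map_fst fst]
      continuous_map_compose[OF continuous_map_snd fst]
      continuous_map_compose[OF continuous_map_fst snd]
      continuous_map_compose[OF continuous_map_snd snd]
    by (simp_all add: o_def)
  have "continuous_map (prod_topology ?X ?X) ?X (\<lambda>z. fst z \<otimes>\<^bsub>?P\<^esub> snd z)"
    unfolding fibre_product_topology_def[of G S K R f g] continuous_map_in_subtopology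
  proof (intro conjI)
    show "continuous_map (prod_topology (subtopology (prod_topology S R) (fibre_product_set G K f g))
        (subtopology (prod_topology S R) (fibre_product_set G K f g))) (prod_topology S R)
        (\<lambda>z. fst z \<otimes>\<^bsub>?P\<^esub> snd z)"
      using mul[OF GD(3) p1 p2] mul[OF KD(3) q1 q2]
      by (simp add: continuous_map_paired flip: fibre_product_topology_def)
    have "fst z \<otimes>\<^bsub>?P\<^esub> snd z \<in> carrier ?P" if "z \<in> carrier ?P \<times> carrier ?P" for z
      using that grp by (metis group.is_monoid mem_Times_iff monoid.m_closed)
    then show "(\<lambda>z. fst z \<otimes>\<^bsub>?P\<^esub> snd z) \<in> topspace (prod_topology
        (subtopology (prod_topology S R) (fibre_product_set G K f g))
        (subtopology (prod_topology S R) (fibre_product_set G K f g))) \<rightarrow> fibre_product_set G K f g"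
      using top by (auto simp del: fibre_product_group_simps(2) simp flip: fibre_product_topology_def)
  qed
  then have 1: "continuous_map (prod_topology ?X ?X) ?X (\<lambda>(x, y). x \<otimes>\<^bsub>?P\<^esub> y)"
    by (simp add: case_prod_unfold)
  have "continuous_map ?X ?X (\<lambda>x. (inv\<^bsub>G\<^esub> fst x, inv\<^bsub>K\<^esub> snd x))"
  proof -
    interpret f: group_hom G H f by (rule fD(5))
    interpret g: group_hom K H g by (rule gD(5))
    have "continuous_map ?X (prod_topology S R) (\<lambda>x. (inv\<^bsub>G\<^esub> fst x, inv\<^bsub>K\<^esub> snd x))"
      using continuous_map_compose[OF fst GD(4)] continuous_map_compose[OF snd KD(4)]
      by (simp add: continuous_map_paired o_def)
    moreover have "(\<lambda>x. (inv\<^bsub>G\<^esub> fst x, inv\<^bsub>K\<^esub> snd x)) \<in> topspace ?X \<rightarrow> fibre_product_set G K f g"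
      unfolding top by (auto simp: fibre_product_set_def)
    ultimately show ?thesis
      by (subst (2) fibre_product_topology_def) (simp add: continuous_map_in_subtopology)
  qed
  then have 2: "continuous_map ?X ?X (\<lambda>x. inv\<^bsub>?P\<^esub> x)"
    by (rule continuous_map_eq) (simp add: top fibre_product_inv[OF fD(5) gD(5)])
  show ?thesis
    using grp top 1 2 by (simp add: topological_group_def)
qed

lemma continuous_hom_fibre_product_snd:
  assumes f: "continuous_hom G S H T f" and g: "continuous_hom K R H T g"
  shows "continuous_hom (fibre_product_group G K f g) (fibre_product_topology G S K R f g) K R snd"
  unfolding continuous_hom_def
proof (intro conjI)
  show "snd \<in> hom (fibre_product_group G K f g) K"
    by (auto simp: hom_def fibre_product_set_def)
  show "continuous_map (fibre_product_topology G S K R f g) R snd"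
    by (auto simp: fibre_product_topology_def
          intro!: continuous_map_from_subtopology continuous_map_snd)
qed (use assms fibre_product_topological_group continuous_homD in blast)+


subsection \<open>Independence of the type of the test groups\<close>


lemma openin_prod_nhd:
  assumes "openin (prod_topology X Y) W" "(x, y) \<in> W"
  obtains U V where "openin X U" "openin Y V" "x \<in> U" "y \<in> V" "U \<times> V \<subseteq> W"
  using assms(1)[unfolded openin_prod_topology_alt, rule_format, OF assms(2)] that by blast

lemma lepoll_iff_card_of: "A \<lesssim> B \<longleftrightarrow> (card_of A, card_of B) \<in> ordLeq"
  by (simp add: lepoll_def card_of_ordLeq)

lemma generate_lepoll:
  fixes G :: "'k monoid" (structure) and X :: "'k set"
  assumes G: "group G" and X: "X \<subseteq> carrier G" "X \<lesssim> (UNIV :: 'w set)" and inf: "infinite (UNIV :: 'w set)"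
  shows "generate G X \<lesssim> (UNIV :: 'w set)"
proof -
  interpret group G by fact
  have small: "Y \<union> Z \<lesssim> (UNIV :: 'w set)" if "Y \<lesssim> (UNIV :: 'w set)" "Z \<lesssim> (UNIV :: 'w set)" for Y Z :: "'k set"
  proof -
    have "(\<Union>b\<in>UNIV. if b then Y else Z) \<lesssim> (UNIV :: 'w set)"
      unfolding lepoll_iff_card_of
      by (rule card_of_UNION_ordLeq_infinite[OF inf])
        (use that finite_lepoll_infinite[OF inf, of "UNIV :: bool set"] in \<open>auto simp: lepoll_iff_card_of\<close>)
    then show ?thesis by (simp add: UNIV_bool Un_commute)
  qed
  define E where "E = rec_nat (insert \<one> (X \<union> (\<lambda>x. inv x) ` X)) (\<lambda>_ D. (\<lambda>(x, y). x \<otimes> y) ` (D \<times> D))"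
  have E0: "E 0 = insert \<one> (X \<union> (\<lambda>x. inv x) ` X)"
    and ES: "E (Suc n) = (\<lambda>(x, y). x \<otimes> y) ` (E n \<times> E n)" for n
    by (simp_all add: E_def)
  have sub: "E n \<subseteq> carrier G" for n
    by (induction n) (use X in \<open>auto simp: E0 ES\<close>)
  have one: "\<one> \<in> E n" for n
    by (induction n) (force simp: E0 ES image_iff)+
  have step: "E n \<subseteq> E (Suc n)" for n
    using one[of n] sub[of n] by (force simp: ES image_iff)
  have mono: "m \<le> n \<Longrightarrow> E m \<subseteq> E n" for m n
    using step by (rule lift_Suc_mono_le)
  have lep: "E n \<lesssim> (UNIV :: 'w set)" for n
  proof (induction n)
    case 0
    have "(\<lambda>x. inv x) ` X \<lesssim> (UNIV :: 'w set)"
      using X(2) image_lepoll lepoll_trans by blast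
    moreover have "{\<one>} \<lesssim> (UNIV :: 'w set)"
      using finite_lepoll_infinite[OF inf, of "{\<one>}"] by simp
    ultimately show ?case
      using small[of "{\<one>}" "X \<union> (\<lambda>x. inv x) ` X"] small X(2) by (simp add: E0)
  next
    case (Suc n)
    have "E n \<times> E n \<lesssim> (UNIV :: 'w set) \<times> (UNIV :: 'w set)"
      using Suc by (intro times_lepoll_mono)
    also have "\<dots> \<lesssim> (UNIV :: 'w set)"
      using card_of_Times_same_infinite[OF inf] by (simp add: lepoll_iff_card_of ordIso_imp_ordLeq)
    finally show ?case
      unfolding ES using image_lepoll lepoll_trans by blast
  qed
  have "generate G X \<subseteq> (\<Union>n. E n)"
  proof
    fix x assume "x \<in> generate G X"
    then show "x \<in> (\<Union>n. E n)"
    proof induction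
      case (eng x y)
      then obtain m n where "x \<in> E m" "y \<in> E n" by auto
      then have "x \<in> E (max m n)" "y \<in> E (max m n)"
        using mono[of m "max m n"] mono[of n "max m n"] by auto
      then have "x \<otimes> y \<in> E (Suc (max m n))"
        by (force simp: ES)
      then show ?case by blast
    qed (use E0 in blast)+
  qed
  moreover have "(\<Union>n. E n) \<lesssim> (UNIV :: 'w set)"
    unfolding lepoll_iff_card_of
  proof (rule card_of_UNION_ordLeq_infinite[OF inf])
    show "(card_of (UNIV :: nat set), card_of (UNIV :: 'w set)) \<in> ordLeq"
      using inf infinite_iff_card_of_nat by blast
    show "\<forall>n\<in>UNIV. (card_of (E n), card_of (UNIV :: 'w set)) \<in> ordLeq"
      using lep by (simp add: lepoll_iff_card_of)
  qed
  ultimately show ?thesis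
    using subset_imp_lepoll lepoll_trans by blast
qed

text \<open>For a test group \<open>K\<close>, a closed subgroup \<open>A\<close> of the fibre product and a point \<open>y\<close> in the
  closure of \<open>snd ` A\<close>, put \<open>N = {n. (1, n) \<in> A}\<close>. A subgroup of \<open>K\<close> generated by \<open>y\<close> and one
  representative of each coset of \<open>N\<close> in \<open>snd ` A\<close> has at most as many elements as
  \<open>'a \<times> nat\<close>; with the topology of the \<open>N\<close>-saturated open sets it is a test group which
  already detects whether \<open>y \<in> snd ` A\<close>.\<close>

lemma c_proper_all_types:
  assumes cp: "c_proper TYPE('a \<times> nat) (G :: 'a monoid) S H T f"
  shows "c_proper TYPE('k) G S H T f"
  unfolding c_proper_def
proof (intro conjI allI impI)
  show f: "continuous_hom G S H T f"
    using cp by (simp add: c_proper_def)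
  fix K :: "'k monoid" and R g
  assume g: "continuous_hom K R H T g"
  note fD = continuous_homD[OF f] and gD = continuous_homD[OF g]
  note GD = topological_groupD[OF fD(1)] and KD = topological_groupD[OF gD(1)]
  interpret f: group_hom G H f by fact
  interpret g: group_hom K H g by fact
  let ?P = "fibre_product_group G K f g" and ?X = "fibre_product_topology G S K R f g"
  let ?PS = "fibre_product_set G K f g"
  have "closedin R (snd ` A)" if A: "subgroup A ?P" and clA: "closedin ?X A" for A
  proof -
    let ?B = "snd ` A"
    have AP: "A \<subseteq> ?PS"
      using subgroup.subset[OF A] by simp
    have Aone: "(\<one>\<^bsub>G\<^esub>, \<one>\<^bsub>K\<^esub>) \<in> A"
      using subgroup.one_closed[OF A] by simp
    have Amul: "(a \<otimes>\<^bsub>G\<^esub> a', b \<otimes>\<^bsub>K\<^esub> b') \<in> A" if "(a, b) \<in> A" "(a', b') \<in> A" for a b a' b'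
      using subgroup.m_closed[OF A that] by simp
    have Ainv: "(inv\<^bsub>G\<^esub> a, inv\<^bsub>K\<^esub> b) \<in> A" if "(a, b) \<in> A" for a b
    proof -
      have "(a, b) \<in> ?PS" using that AP by blast
      then show ?thesis
        using subgroup.m_inv_closed[OF A that] fibre_product_inv[OF fD(5) gD(5), of "(a, b)"] by simp
    qed
    have Acar: "a \<in> carrier G" "b \<in> carrier K" "f a = g b" if "(a, b) \<in> A" for a b
      using that AP by auto
    have BK: "?B \<subseteq> carrier K" using Acar by auto
    obtain C where C: "closedin (prod_topology S R) C" and AC: "A = C \<inter> ?PS"
      using clA by (auto simp: fibre_product_topology_def closedin_subtopology)
    have mulc: "continuous_map Z R (\<lambda>z. p z \<otimes>\<^bsub>K\<^esub> q z)"
      if "continuous_map Z R p" "continuous_map Z R q" for Z :: "'k topology" and p q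
      using continuous_map_compose[of Z "prod_topology R R" "\<lambda>z. (p z, q z)" R "\<lambda>(x, y). x \<otimes>\<^bsub>K\<^esub> y"]
        that KD(3) by (simp add: o_def continuous_map_paired)
    have idc: "continuous_map R R (\<lambda>k. k)"
      using continuous_map_id[of R] by (simp add: id_def)
    have constc: "continuous_map R R (\<lambda>k. c)" if "c \<in> carrier K" for c
      using that by (simp add: KD)

    define N where "N = {n. (\<one>\<^bsub>G\<^esub>, n) \<in> A}"
    have NK: "n \<in> carrier K" and Ng: "g n = \<one>\<^bsub>H\<^esub>" if "n \<in> N" for n
      using that Acar[of "\<one>\<^bsub>G\<^esub>" n] by (auto simp: N_def)
    have None: "\<one>\<^bsub>K\<^esub> \<in> N" using Aone by (simp add: N_def)
    have Nmul: "m \<otimes>\<^bsub>K\<^esub> n \<in> N" if "m \<in> N" "n \<in> N" for m n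
      using Amul[of "\<one>\<^bsub>G\<^esub>" m "\<one>\<^bsub>G\<^esub>" n] that by (simp add: N_def)
    have Ninv: "inv\<^bsub>K\<^esub> n \<in> N" if "n \<in> N" for n
      using Ainv[of "\<one>\<^bsub>G\<^esub>" n] that by (simp add: N_def)
    have AN: "(a, b \<otimes>\<^bsub>K\<^esub> n) \<in> A" if "(a, b) \<in> A" "n \<in> N" for a b n
      using Amul[of a b "\<one>\<^bsub>G\<^esub>" n] that Acar by (simp add: N_def)

    define M where "M = {k \<in> carrier K. \<forall>n\<in>N. k \<otimes>\<^bsub>K\<^esub> n \<otimes>\<^bsub>K\<^esub> inv\<^bsub>K\<^esub> k \<in> N \<and> inv\<^bsub>K\<^esub> k \<otimes>\<^bsub>K\<^esub> n \<otimes>\<^bsub>K\<^esub> k \<in> N}"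
    have subM: "subgroup M K"
    proof (rule g.G.subgroupI)
      show "M \<subseteq> carrier K" by (auto simp: M_def)
      show "M \<noteq> {}" using NK by (auto simp: M_def intro!: exI[of _ "\<one>\<^bsub>K\<^esub>"])
      fix a assume a: "a \<in> M"
      then show "inv\<^bsub>K\<^esub> a \<in> M" by (auto simp: M_def)
      fix b assume b: "b \<in> M"
      have "a \<otimes>\<^bsub>K\<^esub> b \<otimes>\<^bsub>K\<^esub> n \<otimes>\<^bsub>K\<^esub> inv\<^bsub>K\<^esub> (a \<otimes>\<^bsub>K\<^esub> b) = a \<otimes>\<^bsub>K\<^esub> (b \<otimes>\<^bsub>K\<^esub> n \<otimes>\<^bsub>K\<^esub> inv\<^bsub>K\<^esub> b) \<otimes>\<^bsub>K\<^esub> inv\<^bsub>K\<^esub> a"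
        "inv\<^bsub>K\<^esub> (a \<otimes>\<^bsub>K\<^esub> b) \<otimes>\<^bsub>K\<^esub> n \<otimes>\<^bsub>K\<^esub> (a \<otimes>\<^bsub>K\<^esub> b) = inv\<^bsub>K\<^esub> b \<otimes>\<^bsub>K\<^esub> (inv\<^bsub>K\<^esub> a \<otimes>\<^bsub>K\<^esub> n \<otimes>\<^bsub>K\<^esub> a) \<otimes>\<^bsub>K\<^esub> b"
        if "n \<in> N" for n
        using a b NK[OF that] by (auto simp: M_def g.G.m_assoc g.G.inv_mult_group)
      then show "a \<otimes>\<^bsub>K\<^esub> b \<in> M"
        using a b by (auto simp: M_def)
    qed
    have BM: "?B \<subseteq> M"
    proof
      fix b assume "b \<in> ?B"
      then obtain a where ab: "(a, b) \<in> A" by auto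
      have "b \<otimes>\<^bsub>K\<^esub> n \<otimes>\<^bsub>K\<^esub> inv\<^bsub>K\<^esub> b \<in> N" "inv\<^bsub>K\<^esub> b \<otimes>\<^bsub>K\<^esub> n \<otimes>\<^bsub>K\<^esub> b \<in> N" if "n \<in> N" for n
      proof -
        show "b \<otimes>\<^bsub>K\<^esub> n \<otimes>\<^bsub>K\<^esub> inv\<^bsub>K\<^esub> b \<in> N"
          using Amul[OF AN[OF ab that] Ainv[OF ab]] Acar[OF ab] by (simp add: N_def)
        show "inv\<^bsub>K\<^esub> b \<otimes>\<^bsub>K\<^esub> n \<otimes>\<^bsub>K\<^esub> b \<in> N"
          using Amul[OF AN[OF Ainv[OF ab] that] ab] Acar[OF ab] by (simp add: N_def)
      qed
      then show "b \<in> M" using Acar[OF ab] by (simp add: M_def)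
    qed
    have clM: "y \<in> M" if y: "y \<in> R closure_of ?B" for y
    proof -
      have yK: "y \<in> carrier K" using y closure_of_subset_topspace[of R ?B] KD by auto
      have key: "p y \<in> N" if p: "continuous_map R R p" and pB: "\<And>b. b \<in> ?B \<Longrightarrow> p b \<in> N"
        and pg: "\<And>k. k \<in> carrier K \<Longrightarrow> g (p k) = \<one>\<^bsub>H\<^esub>" for p
      proof -
        have c: "continuous_map R (prod_topology S R) (\<lambda>k. (\<one>\<^bsub>G\<^esub>, p k))"
          using p by (simp add: continuous_map_paired GD)
        let ?D = "{k \<in> topspace R. (\<one>\<^bsub>G\<^esub>, p k) \<in> C}"
        have "closedin R ?D" by (rule closedin_continuous_map_preimage[OF c C])
        moreover have "?B \<subseteq> ?D"
          using pB BK KD(2) AC by (auto simp: N_def)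
        ultimately have "y \<in> ?D" using y closure_of_minimal by blast
        moreover have "p y \<in> carrier K"
          using p yK KD(2) by (auto simp: continuous_map_def)
        ultimately show ?thesis using pg[OF yK] by (simp add: N_def AC)
      qed
      have "y \<otimes>\<^bsub>K\<^esub> n \<otimes>\<^bsub>K\<^esub> inv\<^bsub>K\<^esub> y \<in> N" "inv\<^bsub>K\<^esub> y \<otimes>\<^bsub>K\<^esub> n \<otimes>\<^bsub>K\<^esub> y \<in> N" if n: "n \<in> N" for n
      proof -
        show "y \<otimes>\<^bsub>K\<^esub> n \<otimes>\<^bsub>K\<^esub> inv\<^bsub>K\<^esub> y \<in> N"
        proof (rule key)
          show "continuous_map R R (\<lambda>k. k \<otimes>\<^bsub>K\<^esub> n \<otimes>\<^bsub>K\<^esub> inv\<^bsub>K\<^esub> k)"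
            using NK[OF n] by (intro mulc idc constc KD)
        qed (use BM n NK[OF n] Ng[OF n] in \<open>auto simp: M_def\<close>)
        show "inv\<^bsub>K\<^esub> y \<otimes>\<^bsub>K\<^esub> n \<otimes>\<^bsub>K\<^esub> y \<in> N"
        proof (rule key)
          show "continuous_map R R (\<lambda>k. inv\<^bsub>K\<^esub> k \<otimes>\<^bsub>K\<^esub> n \<otimes>\<^bsub>K\<^esub> k)"
            using NK[OF n] by (intro mulc idc constc KD)
        qed (use BM n NK[OF n] Ng[OF n] in \<open>auto simp: M_def\<close>)
      qed
      then show ?thesis using yK by (simp add: M_def)
    qed

    define Q where "Q = topology (\<lambda>W. openin R W \<and> (\<forall>w\<in>W. \<forall>n\<in>N. w \<otimes>\<^bsub>K\<^esub> n \<in> W))"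
    have "istopology (\<lambda>W. openin R W \<and> (\<forall>w\<in>W. \<forall>n\<in>N. w \<otimes>\<^bsub>K\<^esub> n \<in> W))"
      by (auto simp: istopology_def)
    then have openQ: "openin Q W \<longleftrightarrow> openin R W \<and> (\<forall>w\<in>W. \<forall>n\<in>N. w \<otimes>\<^bsub>K\<^esub> n \<in> W)" for W
      by (simp add: Q_def topology_inverse')
    have "openin Q (carrier K)"
      using openin_topspace[of R] NK by (auto simp: openQ KD)
    then have topQ: "topspace Q = carrier K"
      using openQ openin_subset[of R] KD(2) openin_subset by (metis openin_topspace subset_antisym)
    define sat where "sat U = {u \<otimes>\<^bsub>K\<^esub> n | u n. u \<in> U \<and> n \<in> N}" for U
    have satQ: "openin Q (sat U)" and satU: "U \<subseteq> sat U" if U: "openin R U" for U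
    proof -
      have UK: "U \<subseteq> carrier K" using openin_subset[OF U] KD by simp
      show "U \<subseteq> sat U"
        using UK None by (force simp: sat_def)
      have "sat U = (\<Union>n\<in>N. {x \<in> topspace R. x \<otimes>\<^bsub>K\<^esub> inv\<^bsub>K\<^esub> n \<in> U})"
      proof (intro equalityI subsetI)
        fix x assume "x \<in> sat U"
        then obtain u n where "x = u \<otimes>\<^bsub>K\<^esub> n" "u \<in> U" "n \<in> N" by (auto simp: sat_def)
        then show "x \<in> (\<Union>n\<in>N. {x \<in> topspace R. x \<otimes>\<^bsub>K\<^esub> inv\<^bsub>K\<^esub> n \<in> U})"
          using UK NK by (intro UN_I[of n]) (auto simp: KD g.G.m_assoc)
      next
        fix x assume "x \<in> (\<Union>n\<in>N. {x \<in> topspace R. x \<otimes>\<^bsub>K\<^esub> inv\<^bsub>K\<^esub> n \<in> U})"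
        then obtain n where n: "n \<in> N" "x \<in> carrier K" "x \<otimes>\<^bsub>K\<^esub> inv\<^bsub>K\<^esub> n \<in> U" by (auto simp: KD)
        then have "x = (x \<otimes>\<^bsub>K\<^esub> inv\<^bsub>K\<^esub> n) \<otimes>\<^bsub>K\<^esub> n" using NK by (simp add: g.G.m_assoc)
        then show "x \<in> sat U" using n unfolding sat_def by blast
      qed
      moreover have "openin R {x \<in> topspace R. x \<otimes>\<^bsub>K\<^esub> inv\<^bsub>K\<^esub> n \<in> U}" if "n \<in> N" for n
        using that NK by (intro openin_continuous_map_preimage[OF _ U] mulc idc constc) auto
      ultimately have "openin R (sat U)" by auto
      moreover have "w \<otimes>\<^bsub>K\<^esub> n \<in> sat U" if w: "w \<in> sat U" and n: "n \<in> N" for w n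
      proof -
        obtain u m where "w = u \<otimes>\<^bsub>K\<^esub> m" "u \<in> U" "m \<in> N" using w by (auto simp: sat_def)
        then have "w \<otimes>\<^bsub>K\<^esub> n = u \<otimes>\<^bsub>K\<^esub> (m \<otimes>\<^bsub>K\<^esub> n)" "u \<in> U" "m \<otimes>\<^bsub>K\<^esub> n \<in> N"
          using n UK NK Nmul by (auto simp: g.G.m_assoc)
        then show ?thesis unfolding sat_def by blast
      qed
      ultimately show "openin Q (sat U)" by (simp add: openQ)
    qed
    have Qmul: "\<exists>U V. openin Q U \<and> openin Q V \<and> p \<in> U \<and> q \<in> V \<and>
          (\<forall>u\<in>U \<inter> M. \<forall>v\<in>V \<inter> M. u \<otimes>\<^bsub>K\<^esub> v \<in> W)"
      if W: "openin Q W" and pq: "p \<in> carrier K" "q \<in> carrier K" "p \<otimes>\<^bsub>K\<^esub> q \<in> W" for W p q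
    proof -
      have "openin (prod_topology R R) {z \<in> topspace (prod_topology R R). (\<lambda>(x, y). x \<otimes>\<^bsub>K\<^esub> y) z \<in> W}"
        by (rule openin_continuous_map_preimage[OF KD(3)]) (use W openQ in blast)
      moreover have "(p, q) \<in> {z \<in> topspace (prod_topology R R). (\<lambda>(x, y). x \<otimes>\<^bsub>K\<^esub> y) z \<in> W}"
        using pq by (simp add: KD)
      ultimately obtain U V where UV: "openin R U" "openin R V" "p \<in> U" "q \<in> V"
        "U \<times> V \<subseteq> {z \<in> topspace (prod_topology R R). (\<lambda>(x, y). x \<otimes>\<^bsub>K\<^esub> y) z \<in> W}"
        by (rule openin_prod_nhd)
      have "x \<otimes>\<^bsub>K\<^esub> z \<in> W" if xz: "x \<in> sat U" "z \<in> sat V" "z \<in> M" for x z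
      proof -
        obtain u m v n where *: "x = u \<otimes>\<^bsub>K\<^esub> m" "z = v \<otimes>\<^bsub>K\<^esub> n" "u \<in> U" "v \<in> V" "m \<in> N" "n \<in> N"
          using xz by (auto simp: sat_def)
        have c: "u \<in> carrier K" "v \<in> carrier K" "m \<in> carrier K" "n \<in> carrier K" "u \<otimes>\<^bsub>K\<^esub> v \<in> W"
          using * UV NK by (auto simp: KD)
        have N1: "inv\<^bsub>K\<^esub> z \<otimes>\<^bsub>K\<^esub> m \<otimes>\<^bsub>K\<^esub> z \<in> N" using that * by (simp add: M_def)
        have "x \<otimes>\<^bsub>K\<^esub> z = u \<otimes>\<^bsub>K\<^esub> z \<otimes>\<^bsub>K\<^esub> (inv\<^bsub>K\<^esub> z \<otimes>\<^bsub>K\<^esub> m \<otimes>\<^bsub>K\<^esub> z)"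
        proof -
          have "z \<in> carrier K" unfolding *(2) using c(2,4) by (rule g.G.m_closed)
          then have "z \<otimes>\<^bsub>K\<^esub> (inv\<^bsub>K\<^esub> z \<otimes>\<^bsub>K\<^esub> (m \<otimes>\<^bsub>K\<^esub> z)) = m \<otimes>\<^bsub>K\<^esub> z"
            using c(3) by (simp flip: g.G.m_assoc)
          then show ?thesis using \<open>z \<in> carrier K\<close> c(1,3) unfolding *(1) by (simp add: g.G.m_assoc)
        qed
        also have "\<dots> = u \<otimes>\<^bsub>K\<^esub> v \<otimes>\<^bsub>K\<^esub> (n \<otimes>\<^bsub>K\<^esub> (inv\<^bsub>K\<^esub> z \<otimes>\<^bsub>K\<^esub> m \<otimes>\<^bsub>K\<^esub> z))"
        proof -
          have "u \<otimes>\<^bsub>K\<^esub> z \<otimes>\<^bsub>K\<^esub> r = u \<otimes>\<^bsub>K\<^esub> v \<otimes>\<^bsub>K\<^esub> (n \<otimes>\<^bsub>K\<^esub> r)" if "r \<in> carrier K" for r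
            unfolding *(2) using c(1-4) that by (simp add: g.G.m_assoc)
          then show ?thesis using NK[OF N1] .
        qed
        also have "\<dots> \<in> W"
          using W c Nmul[OF *(6) N1] by (simp add: openQ)
        finally show ?thesis .
      qed
      then show ?thesis
        using satQ[OF UV(1)] satQ[OF UV(2)] satU[OF UV(1)] satU[OF UV(2)] UV(3,4)
        by (metis IntD1 IntD2 subsetD)
    qed
    have Qinv: "\<exists>U. openin Q U \<and> p \<in> U \<and> (\<forall>u\<in>U \<inter> M. inv\<^bsub>K\<^esub> u \<in> W)"
      if W: "openin Q W" and p: "p \<in> carrier K" "inv\<^bsub>K\<^esub> p \<in> W" for W p
    proof -
      let ?U = "{k \<in> topspace R. inv\<^bsub>K\<^esub> k \<in> W}"
      have U: "openin R ?U"
        by (rule openin_continuous_map_preimage[OF KD(4)]) (use W openQ in blast)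
      have "inv\<^bsub>K\<^esub> x \<in> W" if x: "x \<in> sat ?U" "x \<in> M" for x
      proof -
        obtain u n where *: "x = u \<otimes>\<^bsub>K\<^esub> n" "u \<in> carrier K" "inv\<^bsub>K\<^esub> u \<in> W" "n \<in> N"
          using x by (auto simp: sat_def KD)
        have xK: "x \<in> carrier K" using * NK by simp
        have N1: "x \<otimes>\<^bsub>K\<^esub> inv\<^bsub>K\<^esub> n \<otimes>\<^bsub>K\<^esub> inv\<^bsub>K\<^esub> x \<in> N"
          using x(2) Ninv[OF *(4)] by (simp add: M_def)
        have "x \<otimes>\<^bsub>K\<^esub> inv\<^bsub>K\<^esub> n = u"
          using * NK by (simp add: g.G.m_assoc)
        then have "inv\<^bsub>K\<^esub> u \<otimes>\<^bsub>K\<^esub> (x \<otimes>\<^bsub>K\<^esub> inv\<^bsub>K\<^esub> n \<otimes>\<^bsub>K\<^esub> inv\<^bsub>K\<^esub> x) = inv\<^bsub>K\<^esub> x"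
          using * xK by (simp flip: g.G.m_assoc)
        then show ?thesis using W *(3) N1 by (metis openQ)
      qed
      then show ?thesis
        using satQ[OF U] satU[OF U] p KD(2) by (intro exI[of _ "sat ?U"]) blast
    qed

    have "R closure_of ?B \<subseteq> ?B"
    proof
      fix y assume y: "y \<in> R closure_of ?B"
      show "y \<in> ?B"
      proof (rule ccontr)
        assume yB: "y \<notin> ?B"
        define \<beta> where "\<beta> a = (SOME b. (a, b) \<in> A)" for a
        have \<beta>: "(a, \<beta> a) \<in> A" if "(a, b) \<in> A" for a b
          unfolding \<beta>_def using that by (rule someI)
        define X where "X = insert y (\<beta> ` (fst ` A))"
        have XM: "X \<subseteq> M" using clM[OF y] BM \<beta> by (force simp: X_def)
        define L0 where "L0 = generate K X"
        have MK: "M \<subseteq> carrier K" by (auto simp: M_def)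
        have subL0: "subgroup L0 K"
          unfolding L0_def using XM MK by (intro g.G.generate_is_subgroup) auto
        have L0M: "L0 \<subseteq> M"
          unfolding L0_def using g.G.generate_subgroup_incl[OF XM subM] .
        have XL0: "X \<subseteq> L0" unfolding L0_def by (auto intro: generate.incl)
        have inf: "infinite (UNIV :: ('a \<times> nat) set)"
          by (simp add: finite_prod)
        have "L0 \<lesssim> (UNIV :: ('a \<times> nat) set)"
          unfolding L0_def
        proof (rule generate_lepoll[OF g.G.is_group _ _ inf])
          show "X \<subseteq> carrier K" using XM MK by blast
          have "X \<lesssim> range (\<lambda>(a :: 'a, n :: nat). if n = 0 then y else \<beta> a)"
            unfolding X_def by (intro subset_imp_lepoll) (force simp: image_iff)
          also have "\<dots> \<lesssim> (UNIV :: ('a \<times> nat) set)" by (rule image_lepoll)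
          finally show "X \<lesssim> (UNIV :: ('a \<times> nat) set)" .
        qed
        then obtain \<phi> :: "'k \<Rightarrow> 'a \<times> nat" where \<phi>: "inj_on \<phi> L0"
          by (auto simp: lepoll_def)
        define \<psi> where "\<psi> = inv_into L0 \<phi>"
        have \<psi>\<phi> [simp]: "\<psi> (\<phi> k) = k" if "k \<in> L0" for k
          using \<phi> that by (simp add: \<psi>_def)
        have \<phi>_eq [simp]: "\<phi> k = \<phi> k' \<longleftrightarrow> k = k'" if "k \<in> L0" "k' \<in> L0" for k k'
          using \<phi> that by (auto simp: inj_on_def)
        define L where "L = \<lparr>carrier = \<phi> ` L0, mult = \<lambda>u v. \<phi> (\<psi> u \<otimes>\<^bsub>K\<^esub> \<psi> v), one = \<phi> \<one>\<^bsub>K\<^esub>\<rparr>"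
        define Y where "Y = pullback_topology (\<phi> ` L0) \<psi> Q"
        have L_simps [simp]: "carrier L = \<phi> ` L0" "u \<otimes>\<^bsub>L\<^esub> v = \<phi> (\<psi> u \<otimes>\<^bsub>K\<^esub> \<psi> v)"
            "\<one>\<^bsub>L\<^esub> = \<phi> \<one>\<^bsub>K\<^esub>" for u v
          by (simp_all add: L_def)
        have L0s [simp]: "\<one>\<^bsub>K\<^esub> \<in> L0" "k \<in> L0 \<Longrightarrow> k' \<in> L0 \<Longrightarrow> k \<otimes>\<^bsub>K\<^esub> k' \<in> L0"
            "k \<in> L0 \<Longrightarrow> inv\<^bsub>K\<^esub> k \<in> L0" "k \<in> L0 \<Longrightarrow> k \<in> carrier K" for k k'
          using subL0 by (auto simp: subgroup_def)
        have grpL: "group L"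
        proof (rule groupI)
          fix x assume "x \<in> carrier L"
          then show "\<exists>y\<in>carrier L. y \<otimes>\<^bsub>L\<^esub> x = \<one>\<^bsub>L\<^esub>"
            by (intro bexI[of _ "\<phi> (inv\<^bsub>K\<^esub> \<psi> x)"]) auto
        qed (auto simp: g.G.m_assoc)
        have invL: "inv\<^bsub>L\<^esub> (\<phi> k) = \<phi> (inv\<^bsub>K\<^esub> k)" if "k \<in> L0" for k
          by (rule group.inv_equality[OF grpL]) (use that in auto)
        have openY: "openin Y W \<longleftrightarrow> (\<exists>U. openin Q U \<and> W = \<psi> -` U \<inter> \<phi> ` L0)" for W
          by (auto simp: Y_def openin_pullback_topology)
        have topY: "topspace Y = \<phi> ` L0"
          by (auto simp: Y_def topspace_pullback_topology topQ)
        have tgL: "topological_group L Y"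
          unfolding topological_group_def
        proof (intro conjI)
          show "topspace Y = carrier L" by (simp add: topY)
          show "continuous_map (prod_topology Y Y) Y (\<lambda>(x, y). x \<otimes>\<^bsub>L\<^esub> y)"
            unfolding continuous_map_def
          proof (intro conjI allI impI)
            show "(\<lambda>(x, y). x \<otimes>\<^bsub>L\<^esub> y) \<in> topspace (prod_topology Y Y) \<rightarrow> topspace Y"
              by (auto simp: topY)
            fix W assume "openin Y W"
            then obtain W' where W': "openin Q W'" "W = \<psi> -` W' \<inter> \<phi> ` L0" by (auto simp: openY)
            show "openin (prod_topology Y Y) {x \<in> topspace (prod_topology Y Y). (case x of (x, y) \<Rightarrow> x \<otimes>\<^bsub>L\<^esub> y) \<in> W}"
              unfolding openin_prod_topology_alt
            proof (intro allI impI)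
              fix u v assume "(u, v) \<in> {x \<in> topspace (prod_topology Y Y). (case x of (x, y) \<Rightarrow> x \<otimes>\<^bsub>L\<^esub> y) \<in> W}"
              then obtain p q where pq: "u = \<phi> p" "v = \<phi> q" "p \<in> L0" "q \<in> L0" "p \<otimes>\<^bsub>K\<^esub> q \<in> W'"
                by (auto simp: topY W')
              then obtain U V where UV: "openin Q U" "openin Q V" "p \<in> U" "q \<in> V"
                  "\<And>u v. u \<in> U \<inter> M \<Longrightarrow> v \<in> V \<inter> M \<Longrightarrow> u \<otimes>\<^bsub>K\<^esub> v \<in> W'"
                using Qmul[OF W'(1), of p q] by auto
              show "\<exists>U V. openin Y U \<and> openin Y V \<and> u \<in> U \<and> v \<in> V \<and>
                  U \<times> V \<subseteq> {x \<in> topspace (prod_topology Y Y). (case x of (x, y) \<Rightarrow> x \<otimes>\<^bsub>L\<^esub> y) \<in> W}"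
              proof (intro exI conjI)
                show "openin Y (\<psi> -` U \<inter> \<phi> ` L0)" "openin Y (\<psi> -` V \<inter> \<phi> ` L0)"
                  using UV by (auto simp: openY)
                have "u \<otimes>\<^bsub>K\<^esub> v \<in> W'" if "u \<in> U" "u \<in> L0" "v \<in> V" "v \<in> L0" for u v
                  using UV(5) that L0M by blast
                then show "(\<psi> -` U \<inter> \<phi> ` L0) \<times> (\<psi> -` V \<inter> \<phi> ` L0)
                    \<subseteq> {x \<in> topspace (prod_topology Y Y). (case x of (x, y) \<Rightarrow> x \<otimes>\<^bsub>L\<^esub> y) \<in> W}"
                  by (auto simp: topY W')
              qed (use UV pq in auto)
            qed
          qed
          show "continuous_map Y Y (\<lambda>x. inv\<^bsub>L\<^esub> x)"
            unfolding continuous_map_def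
          proof (intro conjI allI impI)
            show "(\<lambda>x. inv\<^bsub>L\<^esub> x) \<in> topspace Y \<rightarrow> topspace Y"
              by (auto simp: topY invL)
            fix W assume "openin Y W"
            then obtain W' where W': "openin Q W'" "W = \<psi> -` W' \<inter> \<phi> ` L0" by (auto simp: openY)
            show "openin Y {x \<in> topspace Y. inv\<^bsub>L\<^esub> x \<in> W}"
            proof (subst openin_subopen, intro ballI)
              fix u assume "u \<in> {x \<in> topspace Y. inv\<^bsub>L\<^esub> x \<in> W}"
              then obtain p where p: "u = \<phi> p" "p \<in> L0" "inv\<^bsub>K\<^esub> p \<in> W'"
                by (auto simp: topY W' invL)
              then obtain U where U: "openin Q U" "p \<in> U" "\<And>u. u \<in> U \<inter> M \<Longrightarrow> inv\<^bsub>K\<^esub> u \<in> W'"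
                using Qinv[OF W'(1), of p] by auto
              show "\<exists>T. openin Y T \<and> u \<in> T \<and> T \<subseteq> {x \<in> topspace Y. inv\<^bsub>L\<^esub> x \<in> W}"
              proof (intro exI conjI)
                show "openin Y (\<psi> -` U \<inter> \<phi> ` L0)" using U by (auto simp: openY)
                have "inv\<^bsub>K\<^esub> u \<in> W'" if "u \<in> U" "u \<in> L0" for u
                  using U(3) that L0M by blast
                then show "\<psi> -` U \<inter> \<phi> ` L0 \<subseteq> {x \<in> topspace Y. inv\<^bsub>L\<^esub> x \<in> W}"
                  by (auto simp: topY W' invL)
              qed (use U p in auto)
            qed
          qed
        qed (rule grpL)
        have hom: "continuous_hom L Y H T (\<lambda>u. g (\<psi> u))"
          unfolding continuous_hom_def
        proof (intro conjI)
          show "(\<lambda>u. g (\<psi> u)) \<in> hom L H" by (auto simp: hom_def)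
          show "continuous_map Y T (\<lambda>u. g (\<psi> u))"
            unfolding continuous_map_def
          proof (intro conjI allI impI)
            show "(\<lambda>u. g (\<psi> u)) \<in> topspace Y \<rightarrow> topspace T"
              unfolding topY topological_groupD(2)[OF gD(2)]
            proof
              fix u assume "u \<in> \<phi> ` L0"
              then obtain k where "k \<in> L0" "u = \<phi> k" by blast
              then show "g (\<psi> u) \<in> carrier H" by simp
            qed
            fix W assume "openin T W"
            then have "openin R {k \<in> topspace R. g k \<in> W}"
              by (rule openin_continuous_map_preimage[OF gD(4)])
            then have "openin Q {k \<in> topspace R. g k \<in> W}"
              using NK Ng by (auto simp: openQ KD)
            moreover have "{u \<in> topspace Y. g (\<psi> u) \<in> W} = \<psi> -` {k \<in> topspace R. g k \<in> W} \<inter> \<phi> ` L0"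
              by (auto simp: topY KD)
            ultimately show "openin Y {u \<in> topspace Y. g (\<psi> u) \<in> W}"
              unfolding openY by blast
          qed
        qed (use tgL fD in auto)
        let ?g = "\<lambda>u. g (\<psi> u)"
        let ?P' = "fibre_product_group G L f ?g" and ?X' = "fibre_product_topology G S L Y f ?g"
        define A' where "A' = {(a, u). u \<in> \<phi> ` L0 \<and> (a, \<psi> u) \<in> A}"
        have A'P: "A' \<subseteq> fibre_product_set G L f ?g"
          using Acar by (auto simp: A'_def)
        have "subgroup A' ?P'"
        proof (rule group.subgroupI)
          show "group ?P'"
            using fibre_product_group fD(5) continuous_homD(5)[OF hom] by blast
          show "A' \<subseteq> carrier ?P'" using A'P by simp
          have "(\<one>\<^bsub>G\<^esub>, \<phi> \<one>\<^bsub>K\<^esub>) \<in> A'" using Aone by (simp add: A'_def)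
          then show "A' \<noteq> {}" by blast
          show "inv\<^bsub>?P'\<^esub> x \<in> A'" if "x \<in> A'" for x
          proof -
            have "x \<in> fibre_product_set G L f ?g" using that A'P by blast
            then show ?thesis
              using that Ainv
              by (auto simp: fibre_product_inv[OF fD(5) continuous_homD(5)[OF hom]] A'_def invL)
          qed
          show "x \<otimes>\<^bsub>?P'\<^esub> x' \<in> A'" if "x \<in> A'" "x' \<in> A'" for x x'
            using that Amul by (auto simp: A'_def)
        qed
        moreover have "closedin ?X' A'"
        proof -
          have tX: "topspace ?X' = fibre_product_set G L f ?g"
            using GD topY by (intro topspace_fibre_product) auto
          have "openin ?X' (fibre_product_set G L f ?g - A')"
          proof (subst openin_subopen, intro ballI)
            fix z assume z: "z \<in> fibre_product_set G L f ?g - A'"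
            obtain x k where xk: "z = (x, \<phi> k)" "x \<in> carrier G" "k \<in> L0" "f x = g k" "(x, k) \<notin> A"
            proof -
              obtain x u where xu: "z = (x, u)" by (cases z)
              then have "x \<in> carrier G" "u \<in> \<phi> ` L0" "f x = g (\<psi> u)" "(x, \<psi> u) \<notin> A"
                using z unfolding A'_def by auto
              moreover from this(2) obtain k where "k \<in> L0" "u = \<phi> k" by blast
              ultimately show thesis using xu by (intro that[of x k]) simp_all
            qed
            have "openin (prod_topology S R) (topspace (prod_topology S R) - C)"
              using C by (simp add: closedin_def)
            moreover have "(x, k) \<in> topspace (prod_topology S R) - C"
              using xk by (auto simp: AC GD KD)
            ultimately obtain U V where UV: "openin S U" "openin R V" "x \<in> U" "k \<in> V"
                "U \<times> V \<subseteq> topspace (prod_topology S R) - C"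
              by (rule openin_prod_nhd)
            let ?W = "(U \<times> (\<psi> -` sat V \<inter> \<phi> ` L0)) \<inter> fibre_product_set G L f ?g"
            have dis: "(x', v) \<notin> A" if xv: "x' \<in> U" "v \<in> sat V" for x' v
            proof
              assume A1: "(x', v) \<in> A"
              obtain w n where wn: "v = w \<otimes>\<^bsub>K\<^esub> n" "w \<in> V" "n \<in> N"
                using xv by (auto simp: sat_def)
              have "w \<in> carrier K" using openin_subset[OF UV(2)] wn KD by auto
              then have "v \<otimes>\<^bsub>K\<^esub> inv\<^bsub>K\<^esub> n = w" using wn NK by (simp add: g.G.m_assoc)
              then have "(x', w) \<in> A" using AN[OF A1 Ninv[OF wn(3)]] by simp
              then show False using UV(5) xv wn AC by blast
            qed
            have "openin Y (\<psi> -` sat V \<inter> \<phi> ` L0)"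
              using satQ[OF UV(2)] by (auto simp: openY)
            then have "openin (prod_topology S Y) (U \<times> (\<psi> -` sat V \<inter> \<phi> ` L0))"
              using UV by (simp add: openin_prod_Times_iff)
            then have "openin ?X' ?W"
              by (auto simp: fibre_product_topology_def openin_subtopology)
            moreover have "z \<in> ?W" using xk z UV satU[OF UV(2)] by auto
            moreover have "?W \<subseteq> fibre_product_set G L f ?g - A'"
              using dis by (auto simp: A'_def)
            ultimately show "\<exists>W. openin ?X' W \<and> z \<in> W \<and> W \<subseteq> fibre_product_set G L f ?g - A'"
              by blast
          qed
          then show ?thesis using A'P by (simp add: closedin_def tX)
        qed
        moreover have "c_closed ?P' ?X' L Y snd"
          using cp hom by (simp add: c_proper_def)
        ultimately have "closedin Y (snd ` A')"
          by (simp add: c_closed_def)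
        then obtain W where W: "openin Q W" "\<phi> ` L0 - snd ` A' = \<psi> -` W \<inter> \<phi> ` L0"
          by (auto simp: closedin_def topY openY)
        have yL0: "y \<in> L0" using XL0 by (auto simp: X_def)
        then have "\<phi> y \<notin> snd ` A'"
          using yB by (force simp: A'_def)
        then have "\<phi> y \<in> \<psi> -` W \<inter> \<phi> ` L0"
          using W(2) yL0 by blast
        then have "y \<in> W" using yL0 by simp
        moreover have "openin R W" using W openQ by blast
        ultimately obtain b where b: "b \<in> ?B" "b \<in> W"
          using y unfolding in_closure_of by blast
        then obtain a where a: "(a, b) \<in> A" by auto
        note c = Acar[OF a] Acar[OF \<beta>[OF a]]
        have "inv\<^bsub>K\<^esub> b \<otimes>\<^bsub>K\<^esub> \<beta> a \<in> N"
          using Amul[OF Ainv[OF a] \<beta>[OF a]] c by (simp add: N_def)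
        then have "b \<otimes>\<^bsub>K\<^esub> (inv\<^bsub>K\<^esub> b \<otimes>\<^bsub>K\<^esub> \<beta> a) \<in> W"
          using W(1) b(2) by (simp add: openQ)
        then have bW: "\<beta> a \<in> W" using c by (simp flip: g.G.m_assoc)
        have bL: "\<beta> a \<in> L0" using XL0 a by (force simp: X_def)
        then have "\<phi> (\<beta> a) \<in> \<psi> -` W \<inter> \<phi> ` L0" using bW by simp
        moreover have "(a, \<phi> (\<beta> a)) \<in> A'"
          using bL \<beta>[OF a] by (simp add: A'_def)
        then have "\<phi> (\<beta> a) \<in> snd ` A'" by force
        ultimately show False using W(2) by blast
      qed
    qed
    then show ?thesis
      using BK KD(2) closure_of_subset_eq by metis
  qed
  then show "c_closed ?P ?X K R snd"
    using continuous_hom_fibre_product_snd[OF f g] by (simp add: c_closed_def)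
qed

end

(* Tychonoff's argument by Zorn's lemma. Let A be a closed subgroup of the fibre product over K and
   let y lie in the closure of its projection to K. Consider the partial lifts (J, x), with J a subset
   of I and (x, y) in the closure of the image of A in the fibre product over J. A chain of partial
   lifts has its union as an upper bound, because basic neighbourhoods restrict only finitely many
   coordinates. A partial lift over J extends to one more index i, by taking the
   fibre product over J as test group for f_i: the projection onto it is c-closed, so it maps
   closures of subgroups onto closures. A maximal partial lift is therefore defined on I and lies in A. *)
theory Submission
  imports Defs
begin

text \<open>A continuous map sends the closure of a set into the closure of its image. This is
  applied to inversion, and to multiplication on \<open>A \<times> A\<close>, whose closure is the
  product of the closures.\<close>

lemma subgroup_closure_of:
  assumes G: "topological_group G S" and A: "subgroup A G"
  shows "subgroup (S closure_of A) G"
proof -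
  note GD = topological_groupD[OF G]
  have AS: "A \<subseteq> topspace S"
    using subgroup.subset[OF A] GD by simp
  show ?thesis
  proof (rule group.subgroupI[OF GD(1)])
    show "S closure_of A \<subseteq> carrier G"
      using closure_of_subset_topspace[of S A] GD by simp
    show "S closure_of A \<noteq> {}"
      using closure_of_subset[OF AS] subgroup.one_closed[OF A] by blast
    show "inv\<^bsub>G\<^esub> a \<in> S closure_of A" if "a \<in> S closure_of A" for a
    proof -
      have "inv\<^bsub>G\<^esub> a \<in> S closure_of ((\<lambda>x. inv\<^bsub>G\<^esub> x) ` A)"
        using continuous_map_image_closure_subset[OF GD(4), of A] that by blast
      also have "\<dots> \<subseteq> S closure_of A"
        using subgroup.m_inv_closed[OF A] by (intro closure_of_mono) auto
      finally show ?thesis .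
    qed
    show "a \<otimes>\<^bsub>G\<^esub> b \<in> S closure_of A" if "a \<in> S closure_of A" "b \<in> S closure_of A" for a b
    proof -
      have "a \<otimes>\<^bsub>G\<^esub> b \<in> S closure_of ((\<lambda>(x, y). x \<otimes>\<^bsub>G\<^esub> y) ` (A \<times> A))"
        using continuous_map_image_closure_subset[OF GD(3), of "A \<times> A"] that
        by (force simp: closure_of_Times)
      also have "\<dots> \<subseteq> S closure_of A"
        using subgroup.m_closed[OF A] by (intro closure_of_mono) auto
      finally show ?thesis .
    qed
  qed
qed

text \<open>\<open>c_closed\<close> speaks of closed subgroups only, but the closure of a subgroup
  is again one, so its image is a closed set containing the image of \<open>A\<close>. The other
  inclusion is continuity.\<close>

lemma c_closed_image_closure_of:
  assumes f: "c_closed G S H T f" and A: "subgroup A G"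
  shows "f ` (S closure_of A) = T closure_of (f ` A)"
proof
  have hom: "continuous_hom G S H T f"
    using f by (simp add: c_closed_def)
  note D = continuous_homD[OF hom]
  show "f ` (S closure_of A) \<subseteq> T closure_of (f ` A)"
    by (rule continuous_map_image_closure_subset[OF D(4)])
  have "closedin T (f ` (S closure_of A))"
    using f subgroup_closure_of[OF D(1) A] by (simp add: c_closed_def)
  moreover have "A \<subseteq> S closure_of A"
    using subgroup.subset[OF A] topological_groupD(2)[OF D(1)] by (simp add: closure_of_subset)
  ultimately show "T closure_of (f ` A) \<subseteq> f ` (S closure_of A)"
    by (simp add: closure_of_minimal image_mono)
qed

lemma continuous_hom_compose:
  assumes f: "continuous_hom G S H T f" and g: "continuous_hom H T K R g"
  shows "continuous_hom G S K R (\<lambda>x. g (f x))"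
  using continuous_map_compose[of S T f R g] continuous_homD(1-4)[OF f] continuous_homD(1-4)[OF g]
  by (auto simp: continuous_hom_def o_def hom_def Pi_iff)

lemma topological_group_product:
  assumes "\<And>i. i \<in> I \<Longrightarrow> topological_group (G i) (S i)"
  shows "topological_group (product_group I G) (product_topology S I)"
    (is "topological_group ?G ?S")
proof -
  note GD = topological_groupD[OF assms]
  have top: "topspace ?S = carrier ?G"
    using GD(2) by (auto intro: PiE_cong)
  have "continuous_map (prod_topology ?S ?S) ?S (\<lambda>z. \<lambda>i\<in>I. fst z i \<otimes>\<^bsub>G i\<^esub> snd z i)"
    unfolding continuous_map_componentwise
  proof (intro conjI ballI)
    fix i assume i: "i \<in> I"
    have "continuous_map (prod_topology ?S ?S) (prod_topology (S i) (S i)) (\<lambda>z. (fst z i, snd z i))"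
      using continuous_map_compose[OF continuous_map_fst continuous_map_product_projection[OF i, of S], of ?S]
        continuous_map_compose[OF continuous_map_snd continuous_map_product_projection[OF i, of S], of ?S]
      by (simp add: continuous_map_paired o_def)
    from continuous_map_compose[OF this GD(3)[OF i]] i
    show "continuous_map (prod_topology ?S ?S) (S i) (\<lambda>z. (\<lambda>i\<in>I. fst z i \<otimes>\<^bsub>G i\<^esub> snd z i) i)"
      by (simp add: o_def)
  qed auto
  then have mul: "continuous_map (prod_topology ?S ?S) ?S (\<lambda>(x, y). x \<otimes>\<^bsub>?G\<^esub> y)"
    by (simp add: case_prod_unfold)
  have "continuous_map ?S ?S (\<lambda>x. \<lambda>i\<in>I. inv\<^bsub>G i\<^esub> x i)"
    unfolding continuous_map_componentwise
  proof (intro conjI ballI)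
    fix i assume i: "i \<in> I"
    from continuous_map_compose[OF continuous_map_product_projection[OF i, of S] GD(4)[OF i]] i
    show "continuous_map ?S (S i) (\<lambda>x. (\<lambda>i\<in>I. inv\<^bsub>G i\<^esub> x i) i)"
      by (simp add: o_def)
  qed auto
  \<comment> \<open>The componentwise formula for inverses in \<open>product_group\<close> holds on
    the carrier only, so continuity is transferred by agreement on the topspace.\<close>
  then have "continuous_map ?S ?S (\<lambda>x. inv\<^bsub>?G\<^esub> x)"
    by (rule continuous_map_eq) (use top GD(1) in simp)
  then show ?thesis
    using GD(1) top mul by (simp add: topological_group_def)
qed

lemma continuous_hom_product_projection:
  assumes "\<And>i. i \<in> I \<Longrightarrow> topological_group (G i) (S i)" "i \<in> I"
  shows "continuous_hom (product_group I G) (product_topology S I) (G i) (S i) (\<lambda>x. x i)"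
  using assms topological_group_product[of I G S]
  by (auto simp: continuous_hom_def hom_def)

lemma continuous_hom_product:
  assumes K: "topological_group K R"
    and f: "\<And>i. i \<in> I \<Longrightarrow> continuous_hom K R (H i) (T i) (f i)"
  shows "continuous_hom K R (product_group I H) (product_topology T I) (\<lambda>x. \<lambda>i\<in>I. f i x)"
  unfolding continuous_hom_def
proof (intro conjI)
  note D = continuous_homD[OF f]
  show "topological_group (product_group I H) (product_topology T I)"
    using D(2) by (rule topological_group_product)
  show "(\<lambda>x. \<lambda>i\<in>I. f i x) \<in> hom K (product_group I H)"
    using D(3) by (auto simp: hom_def Pi_iff intro!: restrict_ext)
  show "continuous_map R (product_topology T I) (\<lambda>x. \<lambda>i\<in>I. f i x)"
    using D(4) by (auto simp: continuous_map_componentwise)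
qed (rule K)

text \<open>The projection \<open>snd\<close> is c-closed because \<open>K\<close> is a test group
  for \<open>f\<close>, so \<open>c_closed_image_closure_of\<close> applies to it. Each use supplies
  one new coordinate of a partial lift.\<close>

lemma c_proper_closure_lift:
  fixes K :: "'k monoid"
  assumes f: "c_proper TYPE('k) G S H T f" and g: "continuous_hom K R H T g"
    and B: "subgroup B (fibre_product_group G K f g)" and y: "y \<in> R closure_of (snd ` B)"
  obtains u where "(u, y) \<in> fibre_product_topology G S K R f g closure_of B"
proof -
  have "c_closed (fibre_product_group G K f g) (fibre_product_topology G S K R f g) K R snd"
    using f g by (simp add: c_proper_def)
  then have "y \<in> snd ` (fibre_product_topology G S K R f g closure_of B)"
    using y B by (simp add: c_closed_image_closure_of)
  then show thesis
    using that by auto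
qed

text \<open>By \<open>c_proper_all_types\<close> the instance assumed for each factor gives
  c-properness for test groups of every type, and \<open>'k\<close> is arbitrary, so the statement
  is the unrestricted one. Restricting the product map to \<open>I\<close> puts its values into
  \<open>product_group I H\<close>, whose elements are \<open>undefined\<close> outside
  \<open>I\<close>.\<close>

theorem corollary5p4:
  fixes I :: "'i set"
    and G :: "'i \<Rightarrow> 'g monoid" and S :: "'i \<Rightarrow> 'g topology"
    and H :: "'i \<Rightarrow> 'h monoid" and T :: "'i \<Rightarrow> 'h topology"
    and f :: "'i \<Rightarrow> 'g \<Rightarrow> 'h"
  assumes "\<And>i. i \<in> I \<Longrightarrow> c_proper TYPE('g \<times> nat) (G i) (S i) (H i) (T i) (f i)"
  shows "c_proper TYPE('k)
           (product_group I G) (product_topology S I)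
           (product_group I H) (product_topology T I)
           (\<lambda>x. \<lambda>i\<in>I. f i (x i))"
proof -
  have f: "continuous_hom (G i) (S i) (H i) (T i) (f i)" if "i \<in> I" for i
    using assms[OF that] by (simp add: c_proper_def)
  note fD = continuous_homD[OF f]
  note GD = topological_groupD[OF fD(1)]
  \<comment> \<open>Partial lifts live over subsets \<open>J\<close> of \<open>I\<close>, so the
    product map is formed over each \<open>J\<close>; \<open>F I\<close> is the map of the
    theorem.\<close>
  define F where "F J = (\<lambda>x. \<lambda>i\<in>J. f i (x i))" for J
  have F: "continuous_hom (product_group J G) (product_topology S J)
      (product_group J H) (product_topology T J) (F J)" if J: "J \<subseteq> I" for J
    unfolding F_def
  proof (intro continuous_hom_product)
    show "topological_group (product_group J G) (product_topology S J)"
      using J fD(1) by (auto intro: topological_group_product)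
    show "continuous_hom (product_group J G) (product_topology S J) (H i) (T i) (\<lambda>x. f i (x i))"
      if i: "i \<in> J" for i
    proof -
      have "continuous_hom (product_group J G) (product_topology S J) (G i) (S i) (\<lambda>x. x i)"
        using J fD(1) i by (auto intro!: continuous_hom_product_projection)
      then show ?thesis
        by (rule continuous_hom_compose) (use i J f in blast)
    qed
  qed
  have "closedin R (snd ` A)"
    if g: "continuous_hom (K :: 'k monoid) R (product_group I H) (product_topology T I) g"
      and A: "subgroup A (fibre_product_group (product_group I G) K (F I) g)"
      and clA: "closedin (fibre_product_topology (product_group I G) (product_topology S I) K R (F I) g) A"
    for K R g A
  proof -

    \<comment> \<open>Fibre products over subsets of the index set\<close>
    note gD = continuous_homD[OF g]
    note KD = topological_groupD[OF gD(1)]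
    have gi: "continuous_hom K R (H i) (T i) (\<lambda>k. g k i)" if "i \<in> I" for i
      using continuous_hom_compose[OF g continuous_hom_product_projection] fD(2) that by blast
    define g' where "g' J k = (\<lambda>i\<in>J. g k i)" for J k
    have g': "continuous_hom K R (product_group J H) (product_topology T J) (g' J)" if "J \<subseteq> I" for J
      unfolding g'_def by (rule continuous_hom_product[OF gD(1)]) (use that gi in blast)
    define P where "P J = fibre_product_group (product_group J G) K (F J) (g' J)" for J
    define X where "X J = fibre_product_topology (product_group J G) (product_topology S J) K R (F J) (g' J)" for J
    \<comment> \<open>Closures are computed in the ambient product \<open>Y J\<close> and then cut
      down to \<open>E J\<close>, the underlying set of the fibre product
      \<open>P J\<close>.\<close>
    define Y where "Y J = prod_topology (product_topology S J) R" for J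
    define E where "E J = fibre_product_set (product_group J G) K (F J) (g' J)" for J
    define A' where "A' J = (\<lambda>(a, k). (restrict a J, k)) ` A" for J
    have memE: "(x, k) \<in> E J \<longleftrightarrow> x \<in> (\<Pi>\<^sub>E i\<in>J. carrier (G i)) \<and> k \<in> carrier K \<and> (\<forall>i\<in>J. f i (x i) = g k i)"
      for x k J
      by (auto simp: E_def F_def g'_def fun_eq_iff restrict_def)
    have X: "X J = subtopology (Y J) (E J)" for J
      by (simp add: X_def Y_def E_def fibre_product_topology_def)
    \<comment> \<open>\<open>g\<close> takes values in a product group over \<open>I\<close>, so
      \<open>g' I\<close> agrees with \<open>g\<close> on \<open>carrier K\<close>. Hence
      \<open>E I\<close> is the original fibre product, although the two functions may differ off
      the carrier.\<close>
    have gext: "g k \<in> extensional I" if "k \<in> carrier K" for k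
      using that gD(3) by (auto simp: hom_def PiE_def)
    have EI: "fibre_product_set (product_group I G) K (F I) g = E I"
      using gext by (auto simp: E_def fibre_product_set_def g'_def extensional_restrict)
    have AE: "A \<subseteq> E I"
      using subgroup.subset[OF A] by (simp add: EI)
    have A'E: "A' J \<subseteq> E J" if "J \<subseteq> I" for J
      using AE that by (fastforce simp: A'_def memE)
    have A'I: "A' I = A"
      using AE by (force simp: A'_def memE PiE_def extensional_restrict)
    have clX: "X J closure_of A' J = E J \<inter> Y J closure_of A' J" if "J \<subseteq> I" for J
      unfolding X by (rule closure_of_subtopology_open) (use A'E[OF that] in blast)
    \<comment> \<open>Closedness of \<open>A\<close> enters here only: a lift over all of
      \<open>I\<close> that is a closure point lies in \<open>A\<close> itself.\<close>
    have clA': "X I closure_of A' I = A"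
      using clA by (simp add: A'I X Y_def EI fibre_product_topology_def closure_of_closedin)

    \<comment> \<open>Extending a partial lift by one index\<close>
    have extend: "\<exists>u. ((\<lambda>j\<in>insert i J. if j = i then u else x j), y) \<in> X (insert i J) closure_of A' (insert i J)"
      if J: "J \<subseteq> I" and i: "i \<in> I" "i \<notin> J" and xy: "(x, y) \<in> X J closure_of A' J" for J i x y
    proof -
      \<comment> \<open>\<open>?h\<close> makes \<open>P J\<close> a test group for
        \<open>f i\<close>. A point of \<open>?Q\<close> is a point of the fibre product over
        \<open>insert i J\<close> with its coordinate at \<open>i\<close> split off, and
        \<open>?r\<close> performs this splitting on \<open>A\<close>.\<close>
      let ?h = "\<lambda>z. g (snd z) i"
      let ?Q = "fibre_product_group (G i) (P J) (f i) ?h"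
      let ?Z = "fibre_product_topology (G i) (S i) (P J) (X J) (f i) ?h"
      let ?r = "\<lambda>z. (fst z i, restrict (fst z) J, snd z)"
      have h: "continuous_hom (P J) (X J) (H i) (T i) ?h"
        unfolding P_def X_def
        by (rule continuous_hom_compose[OF continuous_hom_fibre_product_snd[OF F[OF J] g'[OF J]] gi[OF i(1)]])
      have PI: "group (fibre_product_group (product_group I G) K (F I) g)"
        using fibre_product_group[OF continuous_homD(5)[OF F[OF order_refl]] gD(5)] .
      have carP: "carrier (P J) = E J"
        by (simp add: P_def E_def)
      have Q: "group ?Q"
        using fibre_product_group[OF fD(5)[OF i(1)] continuous_homD(5)[OF h]] .
      have "?r \<in> hom (fibre_product_group (product_group I G) K (F I) g) ?Q"
      proof (rule homI)
        fix z assume "z \<in> carrier (fibre_product_group (product_group I G) K (F I) g)"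
        then show "?r z \<in> carrier ?Q"
          using i J by (cases z) (auto simp: EI memE carP)
      next
        fix z w
        show "?r (z \<otimes>\<^bsub>fibre_product_group (product_group I G) K (F I) g\<^esub> w) = ?r z \<otimes>\<^bsub>?Q\<^esub> ?r w"
          using i J by (auto simp: P_def fun_eq_iff restrict_def)
      qed
      then have B: "subgroup (?r ` A) ?Q"
        using PI Q A by (intro group_hom.subgroup_img_is_subgroup) (auto simp: group_hom_def group_hom_axioms_def)
      have "snd ` ?r ` A = A' J"
        by (force simp: A'_def image_image case_prod_unfold)
      then have "(x, y) \<in> X J closure_of (snd ` ?r ` A)"
        using xy by simp
      \<comment> \<open>The elements of \<open>P J\<close> have type
        \<open>('i \<Rightarrow> 'g) \<times> 'k\<close>, so the assumption on \<open>f i\<close> is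
        first carried over to this type by \<open>c_proper_all_types\<close>.\<close>
      then obtain u where u: "(u, x, y) \<in> ?Z closure_of (?r ` A)"
        by (rule c_proper_closure_lift[OF c_proper_all_types[OF assms[OF i(1)]] h B])
      \<comment> \<open>\<open>?m\<close> puts the split coordinate back and turns the image of
        \<open>A\<close> under \<open>?r\<close> into \<open>A' (insert i J)\<close>. Being
        continuous, it preserves closure points.\<close>
      let ?m = "\<lambda>z. ((\<lambda>j\<in>insert i J. if j = i then fst z else fst (snd z) j), snd (snd z))"
      have topX: "topspace (X J) = E J"
        using topological_groupD(2)[OF continuous_homD(1)[OF h]] carP by simp
      have Z1: "continuous_map ?Z (S i) fst" and Z2: "continuous_map ?Z (X J) snd"
        by (auto simp: fibre_product_topology_def
              intro!: continuous_map_from_subtopology continuous_map_fst continuous_map_snd)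
      have X1: "continuous_map (X J) (product_topology S J) fst" and X2: "continuous_map (X J) R snd"
        by (auto simp: X Y_def
              intro!: continuous_map_from_subtopology continuous_map_fst continuous_map_snd)
      have m: "continuous_map ?Z (Y (insert i J)) ?m"
        unfolding Y_def continuous_map_paired
      proof (intro conjI)
        show "continuous_map ?Z (product_topology S (insert i J))
            (\<lambda>z. \<lambda>j\<in>insert i J. if j = i then fst z else fst (snd z) j)"
          unfolding continuous_map_componentwise
        proof (intro conjI ballI)
          fix j assume j: "j \<in> insert i J"
          show "continuous_map ?Z (S j)
              (\<lambda>z. (\<lambda>j\<in>insert i J. if j = i then fst z else fst (snd z) j) j)"
          proof (cases "j = i")
            case True
            then show ?thesis using Z1 by simp
          next
            case False
            then have "j \<in> J" using j by blast
            from continuous_map_compose[OF Z2 continuous_map_compose[OF X1 continuous_map_product_projection[OF this]]]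
            show ?thesis using False j by (simp add: o_def)
          qed
        qed auto
        show "continuous_map ?Z R (\<lambda>z. snd (snd z))"
          using continuous_map_compose[OF Z2 X2] by (simp add: o_def)
      qed
      \<comment> \<open>Closure points stay in the topspace of \<open>?Z\<close>, which yields the
        equation \<open>f i u = g y i\<close> required by \<open>E (insert i J)\<close>.\<close>
      have mem: "(u, x, y) \<in> fibre_product_set (G i) (P J) (f i) ?h"
        using u closure_of_subset_topspace[of ?Z "?r ` A"] topspace_fibre_product[of "S i" "G i" "X J" "P J"]
          GD(2)[OF i(1)] topX carP by blast
      have "?m (u, x, y) \<in> Y (insert i J) closure_of (?m ` ?r ` A)"
        using continuous_map_image_closure_subset[OF m] u by blast
      also have "?m ` ?r ` A = A' (insert i J)"
        by (auto simp: A'_def image_image case_prod_unfold restrict_def intro!: image_cong)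
      finally have "((\<lambda>j\<in>insert i J. if j = i then u else x j), y) \<in> Y (insert i J) closure_of A' (insert i J)"
        by (simp only: fst_conv snd_conv)
      moreover have "((\<lambda>j\<in>insert i J. if j = i then u else x j), y) \<in> E (insert i J)"
        using mem i by (auto simp: memE carP)
      ultimately show ?thesis
        using J i by (auto simp only: clX insert_subset)
    qed

    \<comment> \<open>Passing to the union of a chain\<close>
    have limit: "(x, y) \<in> X (\<Union>\<C>) closure_of A' (\<Union>\<C>)"
      if C: "subset.chain (Pow I) \<C>" "\<C> \<noteq> {}" and x: "x \<in> extensional (\<Union>\<C>)"
        and xy: "\<And>J. J \<in> \<C> \<Longrightarrow> (restrict x J, y) \<in> X J closure_of A' J" for \<C> x y
    proof -
      let ?U = "\<Union>\<C>"
      have CI: "J \<subseteq> I" if "J \<in> \<C>" for J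
        using C that by (auto simp: subset_chain_def)
      then have UI: "?U \<subseteq> I" by blast
      have EJ: "(restrict x J, y) \<in> E J" and YJ: "(restrict x J, y) \<in> Y J closure_of A' J"
        if "J \<in> \<C>" for J
        using xy[OF that] clX[OF CI[OF that]] by auto
      \<comment> \<open>Apart from \<open>y\<close> lying in \<open>K\<close>, this is a condition
        on single coordinates, and each index of the union lies in some member of the chain.\<close>
      have xE: "(x, y) \<in> E ?U"
        unfolding memE
      proof (intro conjI ballI)
        have "x i \<in> carrier (G i) \<and> f i (x i) = g y i" if i: "i \<in> ?U" for i
        proof -
          obtain J where J: "J \<in> \<C>" "i \<in> J" using i by blast
          then show ?thesis using EJ[OF J(1)] by (auto simp: memE)
        qed
        then show "x \<in> (\<Pi>\<^sub>E i\<in>?U. carrier (G i))" "\<And>i. i \<in> ?U \<Longrightarrow> f i (x i) = g y i"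
          using x by (auto simp: PiE_iff)
        show "y \<in> carrier K" using C(2) EJ by (auto simp: memE)
      qed
      have "\<exists>w\<in>A' ?U. w \<in> W" if W: "openin (Y ?U) W" "(x, y) \<in> W" for W
      proof -
        obtain V1 V2 where V: "openin (product_topology S ?U) V1" "openin R V2" "x \<in> V1" "y \<in> V2" "V1 \<times> V2 \<subseteq> W"
          using W unfolding Y_def by (rule openin_prod_nhd)
        obtain B where B: "x \<in> (\<Pi>\<^sub>E i\<in>?U. B i)" "\<And>i. openin (S i) (B i)"
            "finite {i. B i \<noteq> topspace (S i)}" "(\<Pi>\<^sub>E i\<in>?U. B i) \<subseteq> V1"
          using product_topology_open_contains_basis[OF V(1,3)] by blast
        have "finite {i \<in> ?U. B i \<noteq> topspace (S i)}"
          using B(3) by (rule rev_finite_subset) blast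
        \<comment> \<open>A finite set of indices covered by a chain lies in one member;
          nonemptiness of the chain settles the case where no coordinate is restricted.\<close>
        then obtain J where J: "J \<in> \<C>" "{i \<in> ?U. B i \<noteq> topspace (S i)} \<subseteq> J"
          by (rule finite_subset_Union_chain[OF _ _ C(2,1)]) blast+
        have JU: "J \<subseteq> ?U" using J(1) by blast
        have "openin (product_topology S J) (\<Pi>\<^sub>E i\<in>J. B i)"
          using B(2,3) by (intro product_topology_basis) auto
        then have "openin (Y J) ((\<Pi>\<^sub>E i\<in>J. B i) \<times> V2)"
          using V(2) by (simp add: Y_def openin_prod_Times_iff)
        moreover have "(restrict x J, y) \<in> (\<Pi>\<^sub>E i\<in>J. B i) \<times> V2"
          using B(1) JU V(4) by (auto simp: PiE_iff)
        ultimately obtain w where "w \<in> A' J" "w \<in> (\<Pi>\<^sub>E i\<in>J. B i) \<times> V2"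
          using conjunct2[OF YJ[OF J(1), unfolded in_closure_of], rule_format] by metis
        then obtain a k where ak: "(a, k) \<in> A" "restrict a J \<in> (\<Pi>\<^sub>E i\<in>J. B i)" "k \<in> V2"
          by (auto simp: A'_def)
        \<comment> \<open>Closeness to \<open>x\<close> over \<open>J\<close> suffices: at an index
          outside \<open>J\<close> the factor \<open>B i\<close> is the whole space.\<close>
        have "a i \<in> B i" if i: "i \<in> ?U" for i
        proof (cases "i \<in> J")
          case True
          then show ?thesis using ak(2) by (auto simp: PiE_iff)
        next
          case False
          then have "B i = topspace (S i)" using J(2) i by blast
          moreover have "i \<in> I" using UI i by (rule subsetD)
          moreover have "(a, k) \<in> E I" using AE ak(1) by (rule subsetD)
          ultimately show ?thesis using GD(2)[of i] by (simp add: memE PiE_iff)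
        qed
        then have "restrict a ?U \<in> (\<Pi>\<^sub>E i\<in>?U. B i)" by simp
        then have "restrict a ?U \<in> V1" by (rule subsetD[OF B(4)])
        then have "(restrict a ?U, k) \<in> W" using V(5) ak(3) by blast
        moreover have "(restrict a ?U, k) \<in> A' ?U" using ak(1) by (force simp: A'_def)
        ultimately show ?thesis by blast
      qed
      moreover have "(x, y) \<in> topspace (Y ?U)"
        using xE UI GD(2) KD(2) by (auto simp: memE Y_def PiE_iff)
      ultimately have "(x, y) \<in> Y ?U closure_of A' ?U"
        unfolding in_closure_of by blast
      then show ?thesis
        using xE by (simp only: clX[OF UI] Int_iff)
    qed

    \<comment> \<open>Zorn's lemma for partial lifts\<close>
    have "R closure_of (snd ` A) \<subseteq> snd ` A"
    proof
      fix y assume y: "y \<in> R closure_of (snd ` A)"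
      define Z where "Z = {(J, x). J \<subseteq> I \<and> (x, y) \<in> X J closure_of A' J}"
      \<comment> \<open>Extension of lifts. Since the comparison uses \<open>restrict\<close>,
        reflexivity rests on \<open>Zext\<close>: a lift is \<open>undefined\<close> outside its
        index set.\<close>
      define le :: "'i set \<times> ('i \<Rightarrow> 'g) \<Rightarrow> 'i set \<times> ('i \<Rightarrow> 'g) \<Rightarrow> bool"
        where "le p q \<longleftrightarrow> fst p \<subseteq> fst q \<and> snd p = restrict (snd q) (fst p)" for p q
      have Zext: "x \<in> extensional J" if "(J, x) \<in> Z" for J x
        using that by (auto simp: Z_def clX memE PiE_def)
      \<comment> \<open>This lift bounds the empty chain. The product over the empty set is a single
        point, so \<open>?e\<close> is continuous and carries \<open>y\<close> to a closure point of
        \<open>A' {}\<close>.\<close>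
      have base: "({}, \<lambda>_. undefined) \<in> Z"
      proof -
        let ?e = "\<lambda>k. (\<lambda>_. undefined :: 'g, k)"
        have "continuous_map R (Y {}) ?e"
          by (auto simp: Y_def continuous_map_paired continuous_map_componentwise)
        then have "?e ` (R closure_of (snd ` A)) \<subseteq> Y {} closure_of (?e ` snd ` A)"
          by (rule continuous_map_image_closure_subset)
        moreover have "?e ` snd ` A = A' {}"
          by (force simp: A'_def image_image case_prod_unfold)
        moreover have "y \<in> carrier K"
          using y closure_of_subset_topspace[of R] KD(2) by blast
        ultimately show ?thesis
          using y by (auto simp: Z_def clX memE)
      qed
      have "\<exists>m\<in>Z. \<forall>a\<in>Z. le m a \<longrightarrow> a = m"
      proof (rule predicate_Zorn)
        show "partial_order_on Z (relation_of le Z)"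
        proof (rule partial_order_on_relation_ofI)
          show "le p p" if "p \<in> Z" for p
            using that Zext[of "fst p" "snd p"] by (simp add: le_def extensional_restrict)
          show "le p r" if "le p q" "le q r" for p q r
            using that by (auto simp: le_def Int_absorb1)
          show "p = q" if "le p q" "le q p" for p q
            using that by (auto simp: le_def prod_eq_iff)
        qed
        show "\<exists>u\<in>Z. \<forall>a\<in>C. le a u" if C: "C \<in> Chains (relation_of le Z)" for C
        proof (cases "C = {}")
          case True
          then show ?thesis using base by blast
        next
          case False
          have CZ: "C \<subseteq> Z" and cmp: "\<And>p q. p \<in> C \<Longrightarrow> q \<in> C \<Longrightarrow> le p q \<or> le q p"
            using C by (auto simp: Chains_def relation_of_def)
          let ?U = "\<Union>(fst ` C)"
          have "\<forall>i\<in>?U. \<exists>p\<in>C. i \<in> fst p" by blast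
          \<comment> \<open>For each index a member of the chain defined there is chosen.
            Comparability of the members makes the glued \<open>x\<close> restrict to every one of
            them, whatever the choices.\<close>
          then obtain p where p: "\<And>i. i \<in> ?U \<Longrightarrow> p i \<in> C \<and> i \<in> fst (p i)" by metis
          define x where "x = (\<lambda>i\<in>?U. snd (p i) i)"
          have xq: "restrict x (fst q) = snd q" if q: "q \<in> C" for q
          proof (rule extensionalityI[of _ "fst q"])
            show "snd q \<in> extensional (fst q)"
              using q CZ Zext[of "fst q" "snd q"] by auto
            fix i assume i: "i \<in> fst q"
            then have iU: "i \<in> ?U" using q by blast
            show "restrict x (fst q) i = snd q i"
              using cmp[OF q, of "p i"] p[OF iU] i iU by (auto simp: x_def le_def)
          qed auto
          have "(x, y) \<in> X ?U closure_of A' ?U"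
          proof (rule limit)
            show "subset.chain (Pow I) (fst ` C)"
              using CZ cmp by (force simp: subset_chain_def Z_def le_def)
            show "(restrict x J, y) \<in> X J closure_of A' J" if "J \<in> fst ` C" for J
              using that CZ xq by (force simp: Z_def)
          qed (use False in \<open>auto simp: x_def\<close>)
          moreover have "?U \<subseteq> I" using CZ by (fastforce simp: Z_def)
          ultimately have "(?U, x) \<in> Z" by (simp add: Z_def)
          moreover have "le q (?U, x)" if "q \<in> C" for q
            using that xq[OF that] by (auto simp: le_def)
          ultimately show ?thesis by blast
        qed
      qed
      then obtain J x where JZ: "(J, x) \<in> Z" and max: "\<And>a. a \<in> Z \<Longrightarrow> le (J, x) a \<Longrightarrow> a = (J, x)"
        by (metis surj_pair)
      then have m: "J \<subseteq> I" "(x, y) \<in> X J closure_of A' J"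
        by (simp_all add: Z_def)
      \<comment> \<open>At a missing index, \<open>extend\<close> would give a strictly larger lift,
        against maximality.\<close>
      have "J = I"
      proof (rule ccontr)
        assume "J \<noteq> I"
        then obtain i where i: "i \<in> I" "i \<notin> J" using m by blast
        obtain u where u: "((\<lambda>j\<in>insert i J. if j = i then u else x j), y) \<in> X (insert i J) closure_of A' (insert i J)"
          using extend[OF m(1) i m(2)] by blast
        have "le (J, x) (insert i J, \<lambda>j\<in>insert i J. if j = i then u else x j)"
          using i Zext[OF JZ] by (auto simp: le_def fun_eq_iff restrict_def extensional_def)
        then have "insert i J = J"
          using max[of "(insert i J, \<lambda>j\<in>insert i J. if j = i then u else x j)"] u m i by (simp add: Z_def)
        then show False using i by blast
      qed
      then show "y \<in> snd ` A"
        using m clA' by force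
    qed
    moreover have "snd ` A \<subseteq> topspace R"
      using KD(2) AE by (auto simp: memE)
    ultimately show ?thesis
      using closure_of_subset_eq by metis
  qed
  then show ?thesis
    using F[OF order_refl]
    by (simp add: c_proper_def c_closed_def F_def continuous_hom_fibre_product_snd)
qed

end
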